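(* Let $\alpha=(\alpha_0,\dots,\alpha_{m-1})\in\mathbb{N}^m$ with $\alpha_0>0$ and $\alpha_{m-1}>0$, and let $r=|\alpha|=\alpha_0+\cdots+\alpha_{m-1}$. Then the minimum polynomial $\mathrm{mmp}(\alpha)$ of the matrix $A_\alpha$ has the form $$\mathrm{mmp}(\alpha)=x^{w_\alpha}(x-1)^{z_\alpha}\,\mathrm{mmp}((r))$$ for some $w_\alpha,z_\alpha\in\mathbb{N}$, where $\mathrm{mmp}((r))$ is the minimum polynomial of $A_{(r)}$ for the length-one sequence $(r)$.
   Context: $\mathbb{N}=\{0,1,2,\dots\}$. Stern's triangle is the array of integers $a(n,k)$, $n\geq 0$, $k\in\mathbb{Z}$, with $a(0,0)=1$, $a(0,k)=0$ for $k\neq 0$, and for all $n\geq 0$ and all $k\in\mathbb{Z}$: $a(n+1,2k+1)=a(n,k)$ and $a(n+1,2k)=a(n,k-1)+a(n,k)$. (Thus row $n$ has nonzero entries exactly at $0\leq k\leq 2^{n+1}-2$, and $\sum_k a(n,k)x^k=\prod_{i=0}^{n-1}(1+x^{2^i}+x^{2\cdot 2^i})$.) For a finite sequence $\gamma=(\gamma_0,\dots,\gamma_{\ell-1})$ of nonnegative integers define $u_\gamma(n)=\sum_{k\in\mathbb{Z}}\prod_{j=0}^{\ell-1}a(n,k+j)^{\gamma_j}$. This is unchanged by deleting leading or trailing zeros of $\gamma$ and (by the left-right symmetry $a(n,k)=a(n,2^{n+1}-2-k)$) by reversing $\gamma$; call two sequences equivalent if they agree after deleting leading and trailing zeros up to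 reversal, and write $[\gamma]$ for the class. Construction of $A_\alpha$: for a sequence $\beta$, write $u_\beta(n+1)=\sum_k\prod_j a(n+1,k+j)^{\beta_j}$, split the sum over $k$ according to the parity of $k$, substitute $a(n+1,2k'+1)=a(n,k')$ and $a(n+1,2k')=a(n,k'-1)+a(n,k')$, and expand each product into monomials in the $a(n,\cdot)$; each resulting sum $\sum_{k'}\prod_i a(n,k'+i)^{\gamma_i}$ equals $u_\gamma(n)$. Collecting terms by equivalence class gives a formal identity $u_\beta(n+1)=\sum_{[\gamma]}c_{[\beta],[\gamma]}\,u_\gamma(n)$ with nonnegative integer coefficients $c_{[\beta],[\gamma]}$ (all $\gamma$ occurring satisfy $|\gamma|=|\beta|$). Call $[\gamma]$ a child of $[\beta]$ if $c_{[\beta],[\gamma]}\neq 0$. Let $D(\alpha)$ be the set of classes reachable from $[\alpha]$ by zero or more child steps; this set is finite. $A_\alpha$ is the square matrix $(c_{[\beta],[\gamma]})_{[\beta],[\gamma]\in D(\alpha)}$, so that the vector $(u_\beta(n))_{[\beta]\in D(\alpha)}$ at $n+1$ equals $A_\alpha$ times the vector at $n$. For example $A_{(2)}=\begin{pmatrix}3&2\\2&2\end{pmatrix}$ with respect to the classes $[(2)],[(1,1)]$. $\mathrm{mmp}(\alpha)$ denotes the monic polynomial of least degree annihilating $A_\alpha$ (independent of the ordering of $D(\alpha)$). *)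

theory Defs
  imports "Jordan_Normal_Form.Matrix" "HOL-Computational_Algebra.Polynomial"
    "HOL-Library.List_Lexorder" "HOL-Library.FuncSet"
begin

text \<open>Sequences gamma are lists of naturals. Equivalence classes are represented by a
  canonical representative: delete leading and trailing zeros, then take the
  lexicographically smaller of the result and its reversal.\<close>

definition strip0 :: "nat list \<Rightarrow> nat list" where
  "strip0 g = rev (dropWhile (\<lambda>x. x = 0) (rev (dropWhile (\<lambda>x. x = 0) g)))"

definition canon :: "nat list \<Rightarrow> nat list" where
  "canon g = min (strip0 g) (rev (strip0 g))"

text \<open>Formal expansion of u_beta(n+1). For parity p (k = 2k'+p) and factor copy
  (j,c), j < length beta, c < beta!j, the entry a(n+1, 2k'+p+j) is, with q = p+j:
  if q is odd, a(n, k'+(q-1)/2); if q is even, a(n, k'+q/2-1) + a(n, k'+q/2).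
  Shifting indices by +1 (so a(n,k'-1) gets index 0), the variable chosen for a
  copy is  q div 2 + (if odd q then 1 else f(j,c))  where f(j,c) in {0,1} selects the
  summand (f is forced to 0 on copies with odd q, where there is no choice).
  Every term of the fully expanded product is given by such a pair (p,f).\<close>

definition copies :: "nat list \<Rightarrow> (nat \<times> nat) set" where
  "copies b = {(j, c). j < length b \<and> c < b ! j}"

definition var_of :: "nat \<Rightarrow> (nat \<times> nat \<Rightarrow> nat) \<Rightarrow> nat \<times> nat \<Rightarrow> nat" where
  "var_of p f jc = (p + fst jc) div 2 + (if odd (p + fst jc) then 1 else f jc)"

definition expvec :: "nat list \<Rightarrow> nat \<Rightarrow> (nat \<times> nat \<Rightarrow> nat) \<Rightarrow> nat list" where
  "expvec b p f = map (\<lambda>i. card {jc \<in> copies b. var_of p f jc = i}) [0..<length b + 2]"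

definition choices :: "nat list \<Rightarrow> (nat \<times> (nat \<times> nat \<Rightarrow> nat)) set" where
  "choices b = {(p, f). p < 2 \<and> f \<in> copies b \<rightarrow>\<^sub>E {0, 1} \<and>
                  (\<forall>jc \<in> copies b. odd (p + fst jc) \<longrightarrow> f jc = 0)}"

definition coef :: "nat list \<Rightarrow> nat list \<Rightarrow> nat" where
  "coef b g = card {pf \<in> choices b. canon (expvec b (fst pf) (snd pf)) = canon g}"

definition child :: "nat list \<Rightarrow> nat list \<Rightarrow> bool" where
  "child B C \<longleftrightarrow> C = canon C \<and> coef B C \<noteq> 0"

definition Dset :: "nat list \<Rightarrow> nat list set" where
  "Dset a = {C. child\<^sup>*\<^sup>* (canon a) C}"

definition A_mat :: "nat list \<Rightarrow> rat mat" where
  "A_mat a = (let L = sorted_list_of_set (Dset a)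
              in mat (length L) (length L) (\<lambda>(i, j). of_nat (coef (L ! i) (L ! j))))"

definition mat_poly :: "'a::comm_ring_1 poly \<Rightarrow> 'a mat \<Rightarrow> 'a mat" where
  "mat_poly p A = mat (dim_row A) (dim_col A)
     (\<lambda>(i, j). \<Sum>k\<le>degree p. coeff p k * (A ^\<^sub>m k) $$ (i, j))"

definition annihilates :: "'a::comm_ring_1 poly \<Rightarrow> 'a mat \<Rightarrow> bool" where
  "annihilates p A \<longleftrightarrow> mat_poly p A = 0\<^sub>m (dim_row A) (dim_col A)"

definition min_poly :: "'a::field mat \<Rightarrow> 'a poly" where
  "min_poly A = (THE p. lead_coeff p = 1 \<and> annihilates p A \<and>
                    (\<forall>q. lead_coeff q = 1 \<and> annihilates q A \<longrightarrow> degree p \<le> degree q))"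

definition mmp :: "nat list \<Rightarrow> rat poly" where
  "mmp a = min_poly (A_mat a)"

end

theory Submission
  imports Defs "HOL-Computational_Algebra.Polynomial_Factorial"
begin

text \<open>
  One step sends a sequence of length l to sequences of length at most (l+3)/2. So length strictly
  drops while l is at least 4, and lengths at most 3 and at most 2 are preserved. On length 3 the
  step matrix is unipotent: the sum of the two outer entries never increases, and it stays the same
  only for the one term that returns the sequence itself. The classes of length at most 2 and weight
  r are exactly D((r)). Hence the matrix of the step is block triangular with a nilpotent block, a
  unipotent block and the matrix of (r), so its minimum polynomial is a multiple of mmp((r)) and
  divides a product of a power of x, a power of x - 1 and mmp((r)).
\<close>

section \<open>Canonical representatives\<close>

lemma strip0_decomp: "\<exists>m n. g = replicate m 0 @ strip0 g @ replicate n 0"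
proof -
  let ?d = "dropWhile (\<lambda>x::nat. x = 0)" and ?t = "takeWhile (\<lambda>x::nat. x = 0)"
  have t: "?t xs = replicate (length (?t xs)) 0" for xs
    by (induction xs) auto
  have "g = ?t g @ ?d g" by simp
  moreover have "rev (?d g) = ?t (rev (?d g)) @ ?d (rev (?d g))" by simp
  then have "?d g = strip0 g @ rev (?t (rev (?d g)))"
    unfolding strip0_def by (metis rev_append rev_rev_ident)
  ultimately show ?thesis
    using t[of g] t[of "rev (?d g)"] by (metis rev_replicate)
qed

lemma strip0_ends: "strip0 g \<noteq> [] \<Longrightarrow> hd (strip0 g) > 0 \<and> last (strip0 g) > 0"
proof -
  let ?d = "dropWhile (\<lambda>x::nat. x = 0)"
  assume ne: "strip0 g \<noteq> []"
  then have ne1: "?d (rev (?d g)) \<noteq> []" by (simp add: strip0_def)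
  then have ne2: "?d g \<noteq> []" by (metis dropWhile.simps(1) rev.simps(1))
  have "last (strip0 g) = hd (?d (rev (?d g)))"
    by (simp add: strip0_def last_rev)
  moreover have "hd (?d (rev (?d g))) \<noteq> 0" using hd_dropWhile[OF ne1] by simp
  moreover have "hd (strip0 g) = last (?d (rev (?d g)))"
    using ne1 by (simp add: strip0_def hd_rev)
  moreover have "last (?d (rev (?d g))) = last (rev (?d g))"
    using ne1 by (metis last_appendR takeWhile_dropWhile_id)
  moreover have "last (rev (?d g)) \<noteq> 0"
    using hd_dropWhile[OF ne2] ne2 by (simp add: last_rev)
  ultimately show ?thesis by simp
qed

lemma strip0_id:
  assumes "g = [] \<or> hd g > 0 \<and> last g > 0"
  shows "strip0 g = g"
proof (cases "g = []")
  case False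
  with assms have "dropWhile (\<lambda>x. x = 0) g = g"
    by (cases g) auto
  moreover have "dropWhile (\<lambda>x. x = 0) (rev g) = rev g"
    using assms False by (cases g rule: rev_cases) auto
  ultimately show ?thesis by (simp add: strip0_def)
qed (simp add: strip0_def)

lemma strip0_strip0 [simp]: "strip0 (strip0 g) = strip0 g"
  using strip0_id strip0_ends by blast

lemma strip0_padded:
  assumes "s = [] \<or> hd s > 0 \<and> last s > 0"
  shows "strip0 (replicate m 0 @ s @ replicate n 0) = s"
proof -
  let ?d = "dropWhile (\<lambda>x::nat. x = 0)"
  have d: "?d (replicate k 0 @ xs) = ?d xs" for k xs
    by (induction k) auto
  have "?d (s @ replicate n 0) = (if s = [] then [] else s @ replicate n 0)"
    using assms by (cases s) auto
  moreover have "?d (rev s) = rev s"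
    using assms by (cases s rule: rev_cases) auto
  ultimately show ?thesis
    by (simp add: strip0_def d)
qed

lemma strip0_rev: "strip0 (rev g) = rev (strip0 g)"
proof -
  obtain m n where g: "g = replicate m 0 @ strip0 g @ replicate n 0"
    using strip0_decomp by blast
  have "strip0 (rev g) = strip0 (replicate n 0 @ rev (strip0 g) @ replicate m 0)"
    by (subst g) simp
  also have "\<dots> = rev (strip0 g)"
    using strip0_ends[of g] by (intro strip0_padded) (auto simp: hd_rev last_rev)
  finally show ?thesis .
qed

lemma sum_list_strip0 [simp]: "sum_list (strip0 g) = sum_list g"
proof -
  obtain m n where "g = replicate m 0 @ strip0 g @ replicate n 0"
    using strip0_decomp by blast
  then have "sum_list g = sum_list (replicate m 0 @ strip0 g @ replicate n (0::nat))"
    by simp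
  then show ?thesis by (simp add: sum_list_replicate)
qed

lemma canon_cases: "canon g = strip0 g \<or> canon g = rev (strip0 g)"
  by (simp add: canon_def min_def)

lemma canon_canon [simp]: "canon (canon g) = canon g"
  using canon_cases[of g] by (auto simp: canon_def strip0_rev min_def)

lemma sum_list_canon [simp]: "sum_list (canon g) = sum_list g"
  using canon_cases[of g] by (auto simp: sum_list_rev)

lemma length_canon: "length (canon g) = length (strip0 g)"
  using canon_cases[of g] by auto

lemma canon_ends: "canon g \<noteq> [] \<Longrightarrow> hd (canon g) > 0 \<and> last (canon g) > 0"
  using canon_cases[of g] strip0_ends[of g] by (auto simp: hd_rev last_rev)

lemma canon_cong: "strip0 g = strip0 h \<Longrightarrow> canon g = canon h"
  by (simp add: canon_def)

text \<open>The first and last entries of \<open>strip0 e\<close> are nonzero entries of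
  \<open>e\<close>, so the positions of both fall in the window from \<open>lo\<close> to
  \<open>hi\<close>.\<close>

lemma length_strip0_le:
  assumes "\<And>i. i < length e \<Longrightarrow> e ! i \<noteq> 0 \<Longrightarrow> lo \<le> i \<and> i < hi"
  shows "length (strip0 e) \<le> hi - lo"
proof (cases "strip0 e = []")
  case False
  obtain m n where e: "e = replicate m 0 @ strip0 e @ replicate n 0"
    using strip0_decomp by blast
  define s where "s = strip0 e"
  have e: "e = replicate m 0 @ s @ replicate n 0" and s: "s \<noteq> []" "hd s > 0" "last s > 0"
    using e False strip0_ends[OF False] by (auto simp: s_def)
  have "e ! m = hd s" "e ! (m + (length s - 1)) = last s"
    using s by (simp_all add: e nth_append hd_conv_nth last_conv_nth)
  moreover have "m < length e" "m + (length s - 1) < length e"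
    using s by (cases s; simp add: e)+
  ultimately have "lo \<le> m" "m + (length s - 1) < hi"
    using assms s by (metis less_numeral_extra(3))+
  then show ?thesis by (simp add: s_def)
qed simp

section \<open>Children and the set D\<close>

text \<open>Terms of the expansion are kept separate here; the multiplicities \<open>coef\<close>
  arise by counting terms with the same \<open>successor\<close>.\<close>

definition successor :: "nat list \<Rightarrow> nat \<times> (nat \<times> nat \<Rightarrow> nat) \<Rightarrow> nat list" where
  "successor b pf = canon (expvec b (fst pf) (snd pf))"

lemma canon_successor [simp]: "canon (successor b pf) = successor b pf"
  by (simp add: successor_def)

lemma finite_copies [simp]: "finite (copies b)"
  by (rule finite_subset[of _ "Sigma {..<length b} (\<lambda>j. {..<b ! j})"]) (auto simp: copies_def)

lemma card_copies: "card (copies b) = sum_list b"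
proof -
  have "copies b = Sigma {..<length b} (\<lambda>j. {..<b ! j})"
    by (auto simp: copies_def)
  then show ?thesis
    by (simp add: sum_list_sum_nth atLeast0LessThan)
qed

lemma finite_choices [simp]: "finite (choices b)"
  by (rule finite_subset[of _ "{..<2} \<times> (copies b \<rightarrow>\<^sub>E {0, 1})"])
    (auto simp: choices_def intro!: finite_PiE)

lemma choices_value:
  assumes "(p, f) \<in> choices b" "jc \<in> copies b"
  shows "f jc \<le> 1"
  using assms by (fastforce simp: choices_def PiE_iff)

text \<open>At odd parity, position 0 has \<open>q = 1\<close> and uses variable 1, so variable 0
  never occurs. At the top, \<open>q\<close> is at most \<open>length b - 1 + p\<close> and the
  variable at most \<open>(q + 2) div 2\<close>.\<close>

lemma var_of_bounds:
  assumes "(p, f) \<in> choices b" "jc \<in> copies b"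
  shows "p \<le> var_of p f jc" "var_of p f jc < (length b + p + 3) div 2"
proof -
  have "f jc \<le> 1" "fst jc < length b" "p < 2"
    using assms choices_value by (auto simp: choices_def copies_def)
  then show "p \<le> var_of p f jc" "var_of p f jc < (length b + p + 3) div 2"
    by (auto simp: var_of_def elim!: oddE evenE)
qed

lemma length_expvec [simp]: "length (expvec b p f) = length b + 2"
  by (simp add: expvec_def)

lemma expvec_nth:
  "i < length b + 2 \<Longrightarrow> expvec b p f ! i = card {jc \<in> copies b. var_of p f jc = i}"
  unfolding expvec_def by (subst nth_map) (simp_all del: upt_Suc)

lemma expvec_nth_nonzero:
  assumes "(p, f) \<in> choices b" "i < length b + 2" "expvec b p f ! i \<noteq> 0"
  shows "p \<le> i \<and> i < (length b + p + 3) div 2"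
proof -
  have "{jc \<in> copies b. var_of p f jc = i} \<noteq> {}"
    using assms(2,3) expvec_nth by fastforce
  then show ?thesis using var_of_bounds[OF assms(1)] by blast
qed

lemma sum_list_expvec:
  assumes "(p, f) \<in> choices b"
  shows "sum_list (expvec b p f) = sum_list b"
proof -
  have "sum_list (expvec b p f) = (\<Sum>i<length b + 2. card {jc \<in> copies b. var_of p f jc = i})"
    by (simp add: sum_list_sum_nth atLeast0LessThan expvec_nth del: sum.lessThan_Suc)
  also have "\<dots> = card (\<Union>i<length b + 2. {jc \<in> copies b. var_of p f jc = i})"
    by (rule card_UN_disjoint[symmetric]) auto
  also have "(\<Union>i<length b + 2. {jc \<in> copies b. var_of p f jc = i}) = copies b"
  proof -
    \<comment> \<open>The two entries beyond \<open>length b\<close> leave room for every variable,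
      so no copy is lost.\<close>
    have "var_of p f jc < length b + 2" if "jc \<in> copies b" for jc
    proof -
      have "p < 2" using assms by (simp add: choices_def)
      then show ?thesis using var_of_bounds(2)[OF assms that] by linarith
    qed
    then show ?thesis by blast
  qed
  finally show ?thesis by (simp add: card_copies)
qed

lemma sum_list_successor: "pf \<in> choices b \<Longrightarrow> sum_list (successor b pf) = sum_list b"
  by (cases pf) (simp add: successor_def sum_list_expvec)

text \<open>The window of possible variables has \<open>(length b + p + 3) div 2 - p\<close> places.
  For length 3 this is 3 at even parity but only 2 at odd parity.\<close>

lemma length_successor:
  assumes "(p, f) \<in> choices b"
  shows "length (successor b (p, f)) \<le> (length b + 3 - p) div 2"
proof -
  have "length (successor b (p, f)) \<le> (length b + p + 3) div 2 - p"
    unfolding successor_def length_canon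
    by (intro length_strip0_le) (use expvec_nth_nonzero[OF assms] in auto)
  moreover have "p < 2" using assms by (simp add: choices_def)
  ultimately show ?thesis by linarith
qed

lemma length_successor_le:
  "pf \<in> choices b \<Longrightarrow> length (successor b pf) \<le> (length b + 3) div 2"
  using length_successor[of "fst pf" "snd pf" b] by simp

lemma coef_successor: "coef b g = card {pf \<in> choices b. successor b pf = canon g}"
  by (simp add: coef_def successor_def)

lemma child_iff: "child b g \<longleftrightarrow> (\<exists>pf\<in>choices b. successor b pf = g)"
proof -
  have "child b g \<longleftrightarrow> g = canon g \<and> {pf \<in> choices b. successor b pf = canon g} \<noteq> {}"
    by (simp add: child_def coef_successor)
  then show ?thesis by (metis (mono_tags, lifting) Collect_empty_eq canon_successor)
qed

section \<open>Closure and finiteness of the set of reachable classes\<close>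

lemma canon_in_Dset: "canon a \<in> Dset a"
  by (simp add: Dset_def)

lemma successor_in_Dset: "b \<in> Dset a \<Longrightarrow> pf \<in> choices b \<Longrightarrow> successor b pf \<in> Dset a"
  unfolding Dset_def using child_iff by (auto intro: rtranclp.rtrancl_into_rtrancl)

lemma Dset_induct [consumes 1, case_names base step]:
  assumes "b \<in> Dset a" "P (canon a)"
    and "\<And>b pf. b \<in> Dset a \<Longrightarrow> P b \<Longrightarrow> pf \<in> choices b \<Longrightarrow> P (successor b pf)"
  shows "P b"
proof -
  have "child\<^sup>*\<^sup>* (canon a) b" using assms(1) by (simp add: Dset_def)
  then show ?thesis
    by (induction rule: rtranclp_induct) (use assms in \<open>auto simp: Dset_def child_iff\<close>)
qed

lemma Dset_canon: "b \<in> Dset a \<Longrightarrow> canon b = b"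
  by (induction rule: Dset_induct) auto

lemma Dset_sum_list: "b \<in> Dset a \<Longrightarrow> sum_list b = sum_list a"
  by (induction rule: Dset_induct) (auto simp: sum_list_successor)

text \<open>The map from l to (l + 3) div 2 preserves every upper bound that is at least 3; the
  \<open>max 3\<close> makes the bound stable for short starting sequences too.\<close>

lemma Dset_length: "b \<in> Dset a \<Longrightarrow> length b \<le> max 3 (length (canon a))"
proof (induction rule: Dset_induct)
  case (step b pf)
  then show ?case using length_successor_le[of pf b] by linarith
qed simp

text \<open>Length is bounded and every entry is at most the constant weight. Finiteness is what
  lets \<open>sorted_list_of_set\<close> in \<open>A_mat\<close> enumerate
  \<open>Dset a\<close>.\<close>

lemma finite_Dset [simp]: "finite (Dset a)"
proof (rule finite_subset)
  show "Dset a \<subseteq> {g. set g \<subseteq> {..sum_list a} \<and> length g \<le> max 3 (length (canon a))}"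
    using Dset_length Dset_sum_list member_le_sum_list by fastforce
  show "finite {g. set g \<subseteq> {..sum_list a} \<and> length g \<le> max 3 (length (canon a))}"
    by (rule finite_lists_length_le) simp
qed

lemma Dset_mono: "canon b \<in> Dset a \<Longrightarrow> Dset b \<subseteq> Dset a"
  unfolding Dset_def by auto

section \<open>The step as an operator on functions of sequences\<close>

text \<open>Acting on functions on all sequences makes the operator independent of the start sequence, so
  that different matrices A can be compared; see \<open>annihilates_A_mat\<close>.\<close>

definition transfer :: "(nat list \<Rightarrow> rat) \<Rightarrow> nat list \<Rightarrow> rat" where
  "transfer u b = (\<Sum>pf\<in>choices b. u (successor b pf))"

text \<open>Evaluation of the polynomial \<open>p\<close> at the linear operator
  \<open>transfer\<close>; the rules below make functions on sequences a module over the polynomial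
  ring.\<close>

definition act :: "rat poly \<Rightarrow> (nat list \<Rightarrow> rat) \<Rightarrow> nat list \<Rightarrow> rat" where
  "act p u b = (\<Sum>k\<le>degree p. coeff p k * (transfer ^^ k) u b)"

lemma transfer_sum: "transfer (\<lambda>b. \<Sum>k\<in>K. c k * u k b) b = (\<Sum>k\<in>K. c k * transfer (u k) b)"
  unfolding transfer_def sum_distrib_left by (rule sum.swap)

lemma act_bound:
  assumes "degree p \<le> n"
  shows "act p u b = (\<Sum>k\<le>n. coeff p k * (transfer ^^ k) u b)"
  unfolding act_def using assms
  by (intro sum.mono_neutral_left) (auto simp: coeff_eq_0)

lemma act_0 [simp]: "act 0 u b = 0"
  by (simp add: act_def)

lemma act_pCons: "act (pCons c p) u b = c * u b + transfer (act p u) b"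
proof -
  have "act (pCons c p) u b = (\<Sum>k\<le>Suc (degree p). coeff (pCons c p) k * (transfer ^^ k) u b)"
    by (rule act_bound) (simp add: degree_pCons_le)
  also have "\<dots> = c * u b + (\<Sum>k\<le>degree p. coeff p k * transfer ((transfer ^^ k) u) b)"
    by (subst sum.atMost_Suc_shift) simp
  also have "(\<Sum>k\<le>degree p. coeff p k * transfer ((transfer ^^ k) u) b) = transfer (act p u) b"
    unfolding transfer_sum[symmetric] by (simp add: act_def[abs_def])
  finally show ?thesis .
qed

lemma act_add: "act (p + q) u b = act p u b + act q u b"
proof -
  let ?n = "max (degree p) (degree q)"
  have "degree (p + q) \<le> ?n" by (rule degree_add_le) auto
  then show ?thesis
    by (simp add: act_bound[of _ ?n] algebra_simps sum.distrib)
qed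

lemma act_smult: "act (smult c p) u b = c * act p u b"
  by (simp add: act_bound[of "smult c p" "degree p"] act_def sum_distrib_left mult.assoc)

lemma act_mult: "act (p * q) u b = act p (act q u) b"
proof (induction p arbitrary: b)
  case (pCons c p)
  have "act (p * q) u = act p (act q u)" using pCons by auto
  then show ?case by (simp add: act_add act_smult act_pCons)
qed simp

text \<open>Terms are grouped by the class they produce; closure of \<open>Dset a\<close> under
  \<open>successor\<close> ensures that every term is counted.\<close>

lemma transfer_eq_sum_coef:
  assumes "b \<in> Dset a"
  shows "transfer u b = (\<Sum>g\<in>Dset a. of_nat (coef b g) * u g)"
proof -
  have "transfer u b = (\<Sum>g\<in>Dset a. \<Sum>pf\<in>{pf \<in> choices b. successor b pf = g}. u (successor b pf))"
    unfolding transfer_def using successor_in_Dset[OF assms]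
    by (intro sum.group[symmetric]) auto
  also have "\<dots> = (\<Sum>g\<in>Dset a. of_nat (coef b g) * u g)"
    by (intro sum.cong) (auto simp: coef_successor Dset_canon)
  finally show ?thesis .
qed

text \<open>On the closed set \<open>Dset a\<close>, \<open>transfer\<close> is multiplication by
  \<open>A_mat a\<close>. Annihilation becomes a pointwise condition that passes to any smaller set
  \<open>Dset b\<close> without matching matrix indices.\<close>

lemma annihilates_A_mat:
  "annihilates p (A_mat a) \<longleftrightarrow> (\<forall>u. \<forall>b\<in>Dset a. act p u b = 0)"
proof -
  define L where "L = sorted_list_of_set (Dset a)"
  define n where "n = length L"
  define A where "A = A_mat a"
  have L: "set L = Dset a" "distinct L" by (simp_all add: L_def)
  have A: "A \<in> carrier_mat n n"
    by (simp add: A_def A_mat_def Let_def n_def L_def)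
  have A_nth: "A $$ (i, j) = of_nat (coef (L ! i) (L ! j))" if "i < n" "j < n" for i j
    using that by (simp add: A_def A_mat_def Let_def n_def L_def)
  have sum_L: "(\<Sum>g\<in>Dset a. h g) = (\<Sum>j<n. h (L ! j))" for h :: "nat list \<Rightarrow> rat"
    using sum.reindex_bij_betw[OF bij_betw_nth[OF L(2) refl L(1)[symmetric]], of h]
    by (simp add: n_def)
  have tr: "transfer u (L ! i) = (\<Sum>j<n. A $$ (i, j) * u (L ! j))" if "i < n" for u i
  proof -
    have "L ! i \<in> Dset a" using that nth_mem[of i L] by (simp add: n_def L(1))
    then show ?thesis by (simp add: transfer_eq_sum_coef sum_L A_nth that)
  qed
  have pow: "(transfer ^^ k) u (L ! i) = (\<Sum>j<n. (A ^\<^sub>m k) $$ (i, j) * u (L ! j))"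
    if "i < n" for k u i
  proof (induction k arbitrary: u)
    case 0
    have "(\<Sum>j<n. (1\<^sub>m n) $$ (i, j) * u (L ! j)) = (\<Sum>j<n. if j = i then u (L ! j) else 0)"
      using that by (intro sum.cong) auto
    then show ?case using that A by simp
  next
    case (Suc k)
    have Ak: "A ^\<^sub>m k \<in> carrier_mat n n" using A by simp
    \<comment> \<open>The innermost \<open>transfer\<close> is split off and the induction
      hypothesis is applied to \<open>transfer u\<close>, which is why \<open>u\<close> is
      arbitrary.\<close>
    have "(transfer ^^ Suc k) u (L ! i) = (\<Sum>j<n. (A ^\<^sub>m k) $$ (i, j) * transfer u (L ! j))"
      by (simp only: funpow_Suc_right comp_apply Suc)
    also have "\<dots> = (\<Sum>j<n. \<Sum>l<n. (A ^\<^sub>m k) $$ (i, j) * A $$ (j, l) * u (L ! l))"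
      by (simp add: tr sum_distrib_left mult.assoc)
    also have "\<dots> = (\<Sum>l<n. \<Sum>j<n. (A ^\<^sub>m k) $$ (i, j) * A $$ (j, l) * u (L ! l))"
      by (rule sum.swap)
    also have "\<dots> = (\<Sum>l<n. (A ^\<^sub>m Suc k) $$ (i, l) * u (L ! l))"
      using that A Ak
      by (intro sum.cong) (auto simp: scalar_prod_def sum_distrib_right atLeast0LessThan)
    finally show ?case .
  qed
  have mp: "mat_poly p A \<in> carrier_mat n n" using A by (auto simp: mat_poly_def)
  have act: "act p u (L ! i) = (\<Sum>j<n. mat_poly p A $$ (i, j) * u (L ! j))" if "i < n" for u i
  proof -
    have "act p u (L ! i) = (\<Sum>k\<le>degree p. \<Sum>j<n. coeff p k * (A ^\<^sub>m k) $$ (i, j) * u (L ! j))"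
      using that by (simp add: act_def pow sum_distrib_left mult.assoc)
    also have "\<dots> = (\<Sum>j<n. \<Sum>k\<le>degree p. coeff p k * (A ^\<^sub>m k) $$ (i, j) * u (L ! j))"
      by (rule sum.swap)
    also have "\<dots> = (\<Sum>j<n. mat_poly p A $$ (i, j) * u (L ! j))"
      using that A by (intro sum.cong) (auto simp: mat_poly_def sum_distrib_right)
    finally show ?thesis .
  qed
  show ?thesis
  proof
    assume "annihilates p (A_mat a)"
    then have "mat_poly p A = 0\<^sub>m n n" using A by (auto simp: annihilates_def A_def)
    then have "act p u (L ! i) = 0" if "i < n" for u i
      using that by (simp add: act)
    then show "\<forall>u. \<forall>b\<in>Dset a. act p u b = 0"
      by (metis L(1) in_set_conv_nth n_def)
  next
    assume *: "\<forall>u. \<forall>b\<in>Dset a. act p u b = 0"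
    have "mat_poly p A $$ (i, j) = 0" if "i < n" "j < n" for i j
    proof -
      have "L ! i \<in> Dset a" using that nth_mem[of i L] by (simp add: n_def L(1))
      \<comment> \<open>The indicator function of \<open>L ! j\<close> isolates the entry at
        \<open>(i, j)\<close>, because \<open>L\<close> is distinct.\<close>
      then have "0 = act p (\<lambda>g. if g = L ! j then 1 else 0) (L ! i)"
        using * by simp
      also have "\<dots> = (\<Sum>l<n. mat_poly p A $$ (i, l) * (if L ! l = L ! j then 1 else 0))"
        using that by (simp add: act)
      also have "\<dots> = (\<Sum>l<n. if l = j then mat_poly p A $$ (i, l) else 0)"
        using that L(2) by (intro sum.cong) (auto simp: nth_eq_iff_index_eq n_def)
      finally show ?thesis using that by simp
    qed
    then have "mat_poly p A = 0\<^sub>m n n" using mp by (intro eq_matI) auto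
    then show "annihilates p (A_mat a)" using A by (auto simp: annihilates_def A_def)
  qed
qed

section \<open>Minimum polynomials\<close>

text \<open>Gaussian elimination on the vectors \<open>f k\<close>: a pivot \<open>m\<close> clears
  the coordinate \<open>y\<close> of the others, leaving one vector and one coordinate
  fewer.\<close>

lemma nontrivial_relation:
  fixes f :: "'k \<Rightarrow> 'b \<Rightarrow> 'a::field"
  assumes "finite X" "finite K" "card X < card K"
  shows "\<exists>c. (\<exists>k\<in>K. c k \<noteq> 0) \<and> (\<forall>x\<in>X. (\<Sum>k\<in>K. c k * f k x) = 0)"
  using assms
proof (induction X arbitrary: K f rule: finite_induct)
  case empty
  then have "K \<noteq> {}" by auto
  then show ?case by (intro exI[of _ "\<lambda>_. 1"]) auto
next
  case (insert y X)
  show ?case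
  proof (cases "\<forall>k\<in>K. f k y = 0")
    case True
    then show ?thesis using insert.IH[of K f] insert.prems insert.hyps by auto
  next
    case False
    then obtain m where m: "m \<in> K" "f m y \<noteq> 0" by auto
    define g where "g k x = f k x - f k y / f m y * f m x" for k x
    have "card X < card (K - {m})"
      using insert.prems insert.hyps m by simp
    then obtain c where c: "\<exists>k\<in>K - {m}. c k \<noteq> 0"
      "\<And>x. x \<in> X \<Longrightarrow> (\<Sum>k\<in>K - {m}. c k * g k x) = 0"
      using insert.IH[of "K - {m}" g] insert.prems by auto
    \<comment> \<open>The pivot's coefficient collects the multiples of \<open>f m\<close> that were
      subtracted in \<open>g\<close>, so a relation among the \<open>g k\<close> becomes one among
      the \<open>f k\<close>.\<close>
    define d where "d = c(m := - (\<Sum>k\<in>K - {m}. c k * f k y / f m y))"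
    have d: "(\<Sum>k\<in>K. d k * f k x) = (\<Sum>k\<in>K - {m}. c k * g k x)" for x
    proof -
      have "(\<Sum>k\<in>K. d k * f k x) = d m * f m x + (\<Sum>k\<in>K - {m}. d k * f k x)"
        using insert.prems m by (simp add: sum.remove)
      also have "(\<Sum>k\<in>K - {m}. d k * f k x) = (\<Sum>k\<in>K - {m}. c k * f k x)"
        by (intro sum.cong) (auto simp: d_def)
      also have "d m * f m x = - (\<Sum>k\<in>K - {m}. c k * (f k y / f m y * f m x))"
        by (simp add: d_def sum_distrib_right mult.assoc)
      finally show ?thesis by (simp add: g_def right_diff_distrib sum_subtractf)
    qed
    have "g k y = 0" for k using m by (simp add: g_def)
    then have "\<forall>x\<in>insert y X. (\<Sum>k\<in>K. d k * f k x) = 0"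
      using c(2) by (auto simp: d)
    moreover have "\<exists>k\<in>K. d k \<noteq> 0" using c(1) by (auto simp: d_def)
    ultimately show ?thesis by blast
  qed
qed

text \<open>If the matrix has N entries, the N + 1 powers with exponents 0 to N are linearly
  dependent as vectors of entries.\<close>

lemma annihilating_poly_exists:
  fixes A :: "'a::field mat"
  shows "\<exists>p. p \<noteq> 0 \<and> annihilates p A"
proof -
  let ?X = "{..<dim_row A} \<times> {..<dim_col A}"
  let ?K = "{..card ?X}"
  obtain c where c: "\<exists>k\<in>?K. c k \<noteq> 0"
    "\<And>x. x \<in> ?X \<Longrightarrow> (\<Sum>k\<in>?K. c k * (A ^\<^sub>m k) $$ x) = 0"
    using nontrivial_relation[of ?X ?K "\<lambda>k x. (A ^\<^sub>m k) $$ x"] by auto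
  define p where "p = (\<Sum>k\<in>?K. monom (c k) k)"
  have coeff_p: "coeff p k = (if k \<in> ?K then c k else 0)" for k
    by (simp add: p_def coeff_sum)
  have "p \<noteq> 0" using c(1) coeff_p by (metis coeff_0)
  moreover have "(\<Sum>k\<le>degree p. coeff p k * (A ^\<^sub>m k) $$ (i, j)) = 0"
    if "i < dim_row A" "j < dim_col A" for i j
  proof -
    have "degree p \<le> card ?X" by (rule degree_le) (auto simp: coeff_p)
    then have "(\<Sum>k\<le>degree p. coeff p k * (A ^\<^sub>m k) $$ (i, j))
      = (\<Sum>k\<in>?K. coeff p k * (A ^\<^sub>m k) $$ (i, j))"
      by (intro sum.mono_neutral_left) (auto simp: coeff_eq_0)
    also have "\<dots> = (\<Sum>k\<in>?K. c k * (A ^\<^sub>m k) $$ (i, j))"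
      by (intro sum.cong) (auto simp: coeff_p)
    finally show ?thesis using c(2)[of "(i, j)"] that by simp
  qed
  then have "annihilates p A"
    unfolding annihilates_def mat_poly_def by (intro eq_matI) auto
  ultimately show ?thesis by blast
qed

text \<open>The \<open>THE\<close> in \<open>min_poly\<close> needs existence and uniqueness.
  Annihilators form an ideal, so division with remainder shows that one of least degree divides all
  others.\<close>

lemma mmp_properties:
  shows "lead_coeff (mmp a) = 1" and "annihilates (mmp a) (A_mat a)"
    and "annihilates q (A_mat a) \<Longrightarrow> mmp a dvd q"
proof -
  let ?I = "\<lambda>p. annihilates p (A_mat a)"
  have mod: "?I (q mod p)" if "?I p" "?I q" for p q
  proof -
    have "q = q div p * p + q mod p" by simp
    then have "act q u b = act (q div p) (act p u) b + act (q mod p) u b" for u b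
      by (metis act_add act_mult)
    \<comment> \<open>With \<open>act p\<close> outermost, its vanishing on \<open>Dset a\<close>
      for every function applies directly.\<close>
    moreover have "act (q div p) (act p u) b = act p (act (q div p) u) b" for u b
      by (metis act_mult mult.commute)
    ultimately show ?thesis using that by (simp add: annihilates_A_mat)
  qed
  have monic: "\<exists>q'. lead_coeff q' = 1 \<and> ?I q' \<and> degree q' = degree q" if "q \<noteq> 0" "?I q" for q
    using that
    by (intro exI[of _ "smult (inverse (lead_coeff q)) q"]) (auto simp: annihilates_A_mat act_smult)
  obtain p0 where "p0 \<noteq> 0" "?I p0" using annihilating_poly_exists by blast
  then obtain p1 where "lead_coeff p1 = 1 \<and> ?I p1" using monic by blast
  then obtain p where p: "lead_coeff p = 1" "?I p"
    and p_min: "\<And>q. lead_coeff q = 1 \<Longrightarrow> ?I q \<Longrightarrow> degree p \<le> degree q"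
    using ex_has_least_nat[of "\<lambda>q. lead_coeff q = 1 \<and> ?I q" p1 degree] by blast
  have p_dvd: "p dvd q" if "?I q" for q
  proof (rule ccontr)
    assume "\<not> p dvd q"
    then have ne: "q mod p \<noteq> 0" by (simp add: dvd_eq_mod_eq_0)
    then have "degree (q mod p) < degree p"
      using p(1) by (intro degree_mod_less') auto
    with monic[OF ne mod[OF p(2) that]] p_min show False by force
  qed
  have "mmp a = p"
    unfolding mmp_def min_poly_def
  proof (rule the_equality)
    show "lead_coeff p = 1 \<and> ?I p \<and> (\<forall>q. lead_coeff q = 1 \<and> ?I q \<longrightarrow> degree p \<le> degree q)"
      using p p_min by blast
  next
    fix q assume q: "lead_coeff q = 1 \<and> ?I q \<and> (\<forall>s. lead_coeff s = 1 \<and> ?I s \<longrightarrow> degree q \<le> degree s)"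
    then obtain s where s: "q = p * s" using p_dvd by (meson dvdE)
    have "p \<noteq> 0" "s \<noteq> 0" using p q s by auto
    moreover have "degree q = degree p" using p p_min q by (meson le_antisym)
    ultimately have "degree s = 0" by (simp add: s degree_mult_eq)
    moreover have "lead_coeff s = 1" using q p(1) by (simp add: s lead_coeff_mult)
    ultimately have "s = 1" by (metis degree_eq_zeroE coeff_pCons_0 degree_pCons_0 one_pCons)
    then show "q = p" by (simp add: s)
  qed
  then show "lead_coeff (mmp a) = 1" "?I (mmp a)" "?I q \<Longrightarrow> mmp a dvd q"
    using p p_dvd by auto
qed

section \<open>The length filtration\<close>

text \<open>For length at least 3 every odd-parity term is shorter, so the recursion reaches length at
  most 2.\<close>

lemma singleton_reachable:
  assumes "b \<in> Dset a" "sum_list a > 0"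
  shows "[sum_list a] \<in> Dset a"
  using assms(1)
proof (induction "length b" arbitrary: b rule: less_induct)
  case less
  have sum: "sum_list b = sum_list a" using less.prems Dset_sum_list by simp
  consider "length b \<ge> 3" | "length b = 2" | "length b = 1" | "length b = 0"
    by linarith
  then show ?case
  proof cases
    case 1
    \<comment> \<open>Any choice of summands would do at odd parity; the constant 0 is always
      admissible.\<close>
    define f where "f = restrict (\<lambda>_. 0::nat) (copies b)"
    have f: "(1, f) \<in> choices b" by (auto simp: choices_def f_def)
    then have "length (successor b (1, f)) < length b"
      using length_successor[OF f] 1 by linarith
    then show ?thesis using less.hyps successor_in_Dset[OF less.prems f] by blast
  next
    case 2
    then obtain s t where b: "b = [s, t]"
      by (metis One_nat_def Suc_1 length_0_conv length_Suc_conv)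
    \<comment> \<open>At even parity the two factors are a(n,k'-1) + a(n,k') and a(n,k'). Taking the
      second summand throughout leaves a pure power of a(n,k'), which is variable 1.\<close>
    define f where "f = restrict (\<lambda>jc. if fst jc = 0 then 1 else 0::nat) (copies b)"
    have f: "(0, f) \<in> choices b" by (auto simp: choices_def f_def)
    have var: "var_of 0 f jc = 1" if "jc \<in> copies b" for jc
    proof -
      have "fst jc = 0 \<or> fst jc = 1" using that by (auto simp: copies_def b)
      then show ?thesis using that by (auto simp: var_of_def f_def)
    qed
    have "expvec b 0 f ! i = (if i = 1 then sum_list a else 0)" if "i < 4" for i
    proof -
      have "{jc \<in> copies b. var_of 0 f jc = i} = (if i = 1 then copies b else {})"
        using var by auto
      then show ?thesis using that by (simp add: expvec_nth b card_copies sum[symmetric])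
    qed
    then have "expvec b 0 f = replicate 1 0 @ [sum_list a] @ replicate 2 0"
      by (intro nth_equalityI) (auto simp: b nth_append nth_Cons' )
    then have "strip0 (expvec b 0 f) = [sum_list a]"
      using strip0_padded[of "[sum_list a]" 1 2] assms(2) by simp
    then have "successor b (0, f) = [sum_list a]"
      by (simp add: successor_def canon_def)
    then show ?thesis using successor_in_Dset[OF less.prems f] by simp
  next
    case 3
    then obtain s where "b = [s]" by (metis One_nat_def length_0_conv length_Suc_conv)
    then show ?thesis using less.prems sum by simp
  next
    case 4
    then have "sum_list b = 0" by simp
    then show ?thesis using sum assms(2) by linarith
  qed
qed

section \<open>Classes of length at most two\<close>

lemma canon_singleton [simp]: "r > 0 \<Longrightarrow> canon [r] = [r]"
  by (simp add: canon_def strip0_id)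

text \<open>The binomial expansion of (a(n,k'-1) + a(n,k'))^r contains every monomial with exponents
  s and t, s + t = r, so each pair is already a child of \<open>[r]\<close>.\<close>

lemma short_in_Dset_singleton:
  assumes "r > 0" "sum_list b = r" "length b \<le> 2" "canon b = b"
  shows "b \<in> Dset [r]"
proof -
  have r: "[r] \<in> Dset [r]" using canon_in_Dset[of "[r]"] assms(1) by simp
  consider "b = []" | s where "b = [s]" | s t where "b = [s, t]"
    using assms(3) by (cases b rule: remdups_adj.cases) auto
  then show ?thesis
  proof cases
    case (3 s t)
    \<comment> \<open>The first \<open>s\<close> copies take the first summand and the remaining
      \<open>t\<close> copies the second.\<close>
    define f where "f = restrict (\<lambda>jc. if snd jc < s then 0 else 1::nat) (copies [r])"
    have f: "(0, f) \<in> choices [r]" by (auto simp: choices_def f_def copies_def)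
    have st: "s + t = r" using assms(2) 3 by simp
    have var: "var_of 0 f jc = (if snd jc < s then 0 else 1)" if "jc \<in> copies [r]" for jc
      using that by (auto simp: var_of_def f_def copies_def)
    have cop: "copies [r] = {0} \<times> {..<r}" by (auto simp: copies_def)
    have "{jc \<in> copies [r]. var_of 0 f jc = 0} = {0} \<times> {..<s}"
      using var st by (auto simp: cop split: if_splits)
    moreover have "{jc \<in> copies [r]. var_of 0 f jc = 1} = {0} \<times> {s..<r}"
      using var st by (auto simp: cop split: if_splits)
    moreover have "{jc \<in> copies [r]. var_of 0 f jc = 2} = {}"
      using var by auto
    ultimately have "expvec [r] 0 f = [s, t, 0]"
      using st unfolding expvec_def by (simp add: upt_rec numeral_2_eq_2)
    moreover have "canon [s, t, 0] = canon [s, t]"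
    proof -
      have "[s, t] = b" using 3 by simp
      then have "hd [s, t] > 0 \<and> last [s, t] > 0" using canon_ends[of b] assms(4) 3 by auto
      then show ?thesis
        using strip0_padded[of "[s, t]" 0 1] strip0_id[of "[s, t]"] by (intro canon_cong) simp
    qed
    ultimately have "successor [r] (0, f) = b"
      using 3 assms(4) by (simp add: successor_def)
    then show ?thesis using successor_in_Dset[OF r f] by simp
  qed (use assms r in auto)
qed

text \<open>At even parity the product is (x+y)^b0 y^b1 (y+z)^b2. The exponents of x and z are at
  most b0 and b2, with equality in both only for the term that returns \<open>b\<close>. Odd terms
  have length at most 2. So \<open>transfer\<close> acts as the identity modulo lower
  classes.\<close>

lemma transfer_length_three:
  assumes b: "canon b = b" "length b = 3"
    and short: "\<And>pf. pf \<in> choices b \<Longrightarrow> length (successor b pf) \<le> 2 \<Longrightarrow> u (successor b pf) = 0"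
    and three: "\<And>pf. pf \<in> choices b \<Longrightarrow> length (successor b pf) = 3 \<Longrightarrow>
      hd (successor b pf) + last (successor b pf) < hd b + last b \<Longrightarrow> u (successor b pf) = 0"
  shows "transfer u b = u b"
proof -
  obtain b0 b1 b2 where bb: "b = [b0, b1, b2]"
    using b(2) by (auto simp: numeral_3_eq_3 length_Suc_conv)
  have pos: "b0 > 0" "b2 > 0" using canon_ends[of b] b(1) bb by auto
  \<comment> \<open>The choice x from every factor x+y and z from every factor y+z.\<close>
  define f0 where "f0 = restrict (\<lambda>jc. if fst jc = 2 then 1 else 0::nat) (copies b)"
  have f0: "(0, f0) \<in> choices b" by (auto simp: choices_def f0_def)
  have cop: "jc \<in> copies b \<longleftrightarrow>
    (fst jc = 0 \<and> snd jc < b0 \<or> fst jc = 1 \<and> snd jc < b1 \<or> fst jc = 2 \<and> snd jc < b2)" for jc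
    by (cases jc) (auto simp: copies_def bb nth_Cons' less_Suc_eq numeral_3_eq_3)
  let ?C = "\<lambda>j n. Pair j ` {..<n::nat} :: (nat \<times> nat) set"
  have exp0: "{jc \<in> copies b. var_of 0 f jc = 0} = {jc \<in> ?C 0 b0. f jc = 0}"
    and exp2: "{jc \<in> copies b. var_of 0 f jc = 2} = {jc \<in> ?C 2 b2. f jc = 1}"
    if f: "(0, f) \<in> choices b" for f
  proof -
    \<comment> \<open>At position 0 the variable equals \<open>f (0, c)\<close>, so variable 2 can
      come only from position 2.\<close>
    have "f (0, c) \<noteq> 2" if "c < b0" for c
      using choices_value[OF f, of "(0, c)"] that by (auto simp: cop)
    then show "{jc \<in> copies b. var_of 0 f jc = 0} = {jc \<in> ?C 0 b0. f jc = 0}"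
      "{jc \<in> copies b. var_of 0 f jc = 2} = {jc \<in> ?C 2 b2. f jc = 1}"
      by (auto simp: cop var_of_def image_iff)
  qed
  have main: "u (successor b (p, f)) = 0" if pf: "(p, f) \<in> choices b" "(p, f) \<noteq> (0, f0)" for p f
  proof (cases "p = 0")
    case False
    then have "length (successor b (p, f)) \<le> 2"
      using length_successor[OF pf(1)] b(2) by simp
    then show ?thesis using short pf by blast
  next
    case True
    then have f: "(0, f) \<in> choices b" "f \<noteq> f0" using pf by auto
    define e where "e = expvec b 0 f"
    define e0 where "e0 = e ! 0"
    define e1 where "e1 = e ! 1"
    define e2 where "e2 = e ! 2"
    have e0: "e0 = card {jc \<in> ?C 0 b0. f jc = 0}"
      using exp0[OF f(1)] by (simp add: e0_def e_def expvec_nth)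
    have e2: "e2 = card {jc \<in> ?C 2 b2. f jc = 1}"
      using exp2[OF f(1)] by (simp add: e2_def e_def expvec_nth bb)
    have cards: "card (?C 0 b0) = b0" "card (?C 2 b2) = b2"
      by (simp_all add: card_image inj_on_def)
    have le: "e0 \<le> b0" "e2 \<le> b2"
      using card_mono[of "?C 0 b0" "{jc \<in> ?C 0 b0. f jc = 0}"]
        card_mono[of "?C 2 b2" "{jc \<in> ?C 2 b2. f jc = 1}"]
      by (auto simp: e0 e2 cards)
    have less: "e0 + e2 < b0 + b2"
    proof (rule ccontr)
      assume "\<not> ?thesis"
      then have "e0 = b0" "e2 = b2" using le by auto
      then have "card {jc \<in> ?C 0 b0. f jc = 0} = card (?C 0 b0)"
        "card {jc \<in> ?C 2 b2. f jc = 1} = card (?C 2 b2)"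
        using e0 e2 cards by linarith+
      then have "{jc \<in> ?C 0 b0. f jc = 0} = ?C 0 b0" "{jc \<in> ?C 2 b2. f jc = 1} = ?C 2 b2"
        by (intro card_subset_eq; blast)+
      then have *: "\<And>c. c < b0 \<Longrightarrow> f (0, c) = 0" "\<And>c. c < b2 \<Longrightarrow> f (2, c) = 1"
        by blast+
      \<comment> \<open>Copies at position 1 have odd \<open>q\<close> and a forced value; outside
        \<open>copies b\<close> both functions are undefined by extensionality.\<close>
      have "f jc = f0 jc" for jc
      proof (cases "jc \<in> copies b")
        case True
        moreover have "f jc = 0" if "fst jc = 1"
          using f(1) True that by (auto simp: choices_def)
        ultimately show ?thesis
          using * by (cases jc) (auto simp: f0_def cop)
      next
        case False
        then show ?thesis
          using f(1) PiE_arb[of f "copies b" "\<lambda>_. {0, 1}" jc] by (simp add: choices_def f0_def)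
      qed
      then have "f = f0" by (rule ext)
      then show False using f(2) by simp
    qed
    have len_e: "length e = 5" by (simp add: e_def bb)
    have zero: "e ! 3 = 0" "e ! 4 = 0"
      using expvec_nth_nonzero[OF f(1), of 3] expvec_nth_nonzero[OF f(1), of 4]
      by (auto simp: e_def b(2))
    have e: "e = [e0, e1, e2] @ replicate 2 0"
      using len_e zero
      by (auto simp: list_eq_iff_nth_eq e0_def e1_def e2_def less_Suc_eq numeral_eq_Suc)
    show ?thesis
    proof (cases "e0 > 0 \<and> e2 > 0")
      case True
      then have "strip0 e = [e0, e1, e2]"
        using strip0_padded[of "[e0, e1, e2]" 0 2] by (simp add: e)
      \<comment> \<open>The representative may be reversed, but the sum of its two ends is the same
        either way.\<close>
      then have "successor b (0, f) = [e0, e1, e2] \<or> successor b (0, f) = [e2, e1, e0]"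
        using canon_cases[of e] by (auto simp: successor_def e_def)
      then show ?thesis using three[OF f(1)] less \<open>p = 0\<close> by (auto simp: bb)
    next
      case False
      have "length (strip0 e) \<le> 2"
      proof (cases "e0 = 0")
        case True
        have "length (strip0 e) \<le> 3 - 1"
          by (rule length_strip0_le) (use True in \<open>auto simp: e less_Suc_eq numeral_eq_Suc\<close>)
        then show ?thesis by simp
      next
        case e0_ne: False
        have "length (strip0 e) \<le> 2 - 0"
          by (rule length_strip0_le)
            (use False e0_ne in \<open>auto simp: e less_Suc_eq numeral_eq_Suc\<close>)
        then show ?thesis by simp
      qed
      then have "length (successor b (0, f)) \<le> 2"
        by (simp add: successor_def length_canon e_def)
      then show ?thesis using short[OF f(1)] \<open>p = 0\<close> by simp
    qed
  qed
  have "transfer u b = (\<Sum>pf\<in>{(0, f0)}. u (successor b pf))"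
    unfolding transfer_def
  proof (rule sum.mono_neutral_right)
    show "\<forall>pf\<in>choices b - {(0, f0)}. u (successor b pf) = 0"
      using main by (metis DiffE singletonI surj_pair)
  qed (use f0 in simp_all)
  moreover have "successor b (0, f0) = b"
  proof -
    define e where "e = expvec b 0 f0"
    have "{jc \<in> copies b. var_of 0 f0 jc = i} =
      (if i = 0 then ?C 0 b0 else if i = 1 then ?C 1 b1 else if i = 2 then ?C 2 b2 else {})" for i
      by (auto simp: cop var_of_def f0_def image_iff split: if_splits)
    then have "expvec b 0 f0 = b @ replicate 2 0"
      unfolding expvec_def by (simp add: bb upt_rec numeral_eq_Suc card_image inj_on_def)
    moreover have "strip0 (b @ replicate 2 0) = b"
      using strip0_padded[of b 0 2] pos bb by simp
    moreover have "strip0 b = b"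
      using pos bb by (intro strip0_id) auto
    ultimately have "canon (expvec b 0 f0) = canon b"
      by (intro canon_cong) simp
    then show ?thesis using b(1) by (simp add: successor_def)
  qed
  ultimately show ?thesis by simp
qed

section \<open>Annihilating the unipotent and nilpotent layers\<close>

lemma act_power_Suc: "act (q ^ Suc n * p) u b = act q (act (q ^ n * p) u) b"
  by (simp add: act_mult[symmetric] mult.assoc)

lemma act_X: "act [:0, 1:] u b = transfer u b"
proof -
  have "act [:1:] u = u" by (rule ext) (simp add: act_def)
  then show ?thesis by (simp add: act_pCons)
qed

lemma act_X_minus_1: "act [:-1, 1:] u b = transfer u b - u b"
proof -
  have "act [:1:] u = u" by (rule ext) (simp add: act_def)
  then show ?thesis by (simp add: act_pCons)
qed

lemma transfer_eq_0: "(\<And>pf. pf \<in> choices b \<Longrightarrow> u (successor b pf) = 0) \<Longrightarrow> transfer u b = 0"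
  by (simp add: transfer_def)

text \<open>Each factor x - 1 clears one level of the sum of the ends: by induction all terms other
  than \<open>b\<close> itself already vanish, and \<open>transfer_length_three\<close> makes the
  difference 0.\<close>

lemma annihilate_length_three:
  assumes b: "b \<in> Dset a" "length b \<le> 3" "length b = 3 \<Longrightarrow> hd b + last b < n"
    and p: "\<And>g. g \<in> Dset a \<Longrightarrow> length g \<le> 2 \<Longrightarrow> act p u g = 0"
  shows "act ([:-1, 1:] ^ n * p) u b = 0"
  using b
proof (induction n arbitrary: b)
  case 0
  \<comment> \<open>No sum of ends is below 0, so only lengths at most 2 remain.\<close>
  then have "length b \<noteq> 3" by blast
  then show ?case using p 0 by simp
next
  case (Suc n)
  let ?v = "act ([:-1, 1:] ^ n * p) u"
  have *: "act ([:-1, 1:] ^ Suc n * p) u b = transfer ?v b - ?v b"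
    by (simp only: act_power_Suc act_X_minus_1)
  have "transfer ?v b = ?v b"
  proof (cases "length b = 3")
    case True
    show ?thesis
    proof (rule transfer_length_three)
      show "canon b = b" using Suc.prems Dset_canon by blast
    next
      fix pf assume "pf \<in> choices b" "length (successor b pf) \<le> 2"
      then show "?v (successor b pf) = 0"
        using Suc.prems successor_in_Dset by (intro Suc.IH) auto
    next
      fix pf assume "pf \<in> choices b" "length (successor b pf) = 3"
        "hd (successor b pf) + last (successor b pf) < hd b + last b"
      then show "?v (successor b pf) = 0"
        using True Suc.prems successor_in_Dset by (intro Suc.IH) auto
    qed (rule True)
  next
    case False
    then have len: "length b \<le> 2" using Suc.prems by simp
    \<comment> \<open>Lengths at most 2 are preserved, and there the previous power already gives
      0.\<close>
    have "transfer ?v b = 0"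
    proof (rule transfer_eq_0, rule Suc.IH)
      fix pf assume pf: "pf \<in> choices b"
      then have "length (successor b pf) \<le> 2" using length_successor_le[OF pf] len by linarith
      then show "length (successor b pf) \<le> 3"
        "length (successor b pf) = 3 \<Longrightarrow> hd (successor b pf) + last (successor b pf) < n" by auto
      show "successor b pf \<in> Dset a" using pf Suc.prems successor_in_Dset by blast
    qed
    moreover have "?v b = 0" using Suc.prems len by (intro Suc.IH) auto
    ultimately show ?thesis by simp
  qed
  then show ?case using * by simp
qed

text \<open>Length at most n + 4 drops to at most (n + 7) div 2, hence to at most n + 3, so one
  factor x pays for one unit of length.\<close>

lemma annihilate_long:
  assumes b: "b \<in> Dset a" "length b \<le> n + 3"
    and p: "\<And>g. g \<in> Dset a \<Longrightarrow> length g \<le> 3 \<Longrightarrow> act p u g = 0"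
  shows "act ([:0, 1:] ^ n * p) u b = 0"
  using b
proof (induction n arbitrary: b)
  case 0
  then show ?case using p by simp
next
  case (Suc n)
  have "transfer (act ([:0, 1:] ^ n * p) u) b = 0"
  proof (rule transfer_eq_0, rule Suc.IH)
    fix pf assume pf: "pf \<in> choices b"
    then show "length (successor b pf) \<le> n + 3"
      using length_successor_le[OF pf] Suc.prems by linarith
    show "successor b pf \<in> Dset a" using pf Suc.prems successor_in_Dset by blast
  qed
  then show ?case by (simp only: act_power_Suc act_X)
qed

text \<open>A linear factor is prime. If it divides \<open>q\<close>, it is cancelled on both sides
  and counted in \<open>k\<close>; otherwise it divides the cofactor and one power is
  dropped.\<close>

lemma dvd_linear_power_mult:
  fixes q :: "'a::field poly"
  assumes "q dvd [:c, 1:] ^ n * t"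
  shows "\<exists>k s. q = [:c, 1:] ^ k * s \<and> s dvd t"
  using assms
proof (induction n arbitrary: q)
  case 0
  then show ?case by (intro exI[of _ 0] exI[of _ q]) auto
next
  case (Suc n)
  have prime: "prime_elem [:c, 1:]"
    by (rule prime_elem_linear_field_poly) simp
  show ?case
  proof (cases "[:c, 1:] dvd q")
    case True
    then obtain q' where q': "q = [:c, 1:] * q'" by (elim dvdE)
    have "[:c, 1:] * q' dvd [:c, 1:] * ([:c, 1:] ^ n * t)"
      using Suc.prems by (simp only: q' power_Suc mult.assoc)
    moreover have "[:c, 1:] \<noteq> 0" by simp
    ultimately have "q' dvd [:c, 1:] ^ n * t"
      by (metis dvd_times_left_cancel_iff)
    from Suc.IH[OF this] obtain k s where "q' = [:c, 1:] ^ k * s" "s dvd t" by blast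
    then show ?thesis by (intro exI[of _ "Suc k"] exI[of _ s]) (simp only: q' power_Suc mult.assoc simp_thms)
  next
    case False
    moreover obtain u where u: "[:c, 1:] * ([:c, 1:] ^ n * t) = q * u"
      using Suc.prems by (metis dvdE power_Suc mult.assoc)
    then have "[:c, 1:] dvd q * u" by (metis dvd_triv_left)
    ultimately obtain v where "u = [:c, 1:] * v"
      using prime by (metis prime_elem_dvd_mult_iff dvdE)
    then have "[:c, 1:] * ([:c, 1:] ^ n * t) = [:c, 1:] * (q * v)"
      by (simp only: u mult.left_commute)
    moreover have "[:c, 1:] \<noteq> 0" by simp
    ultimately have "q dvd [:c, 1:] ^ n * t"
      by (metis mult_left_cancel dvd_triv_left)
    then show ?thesis by (rule Suc.IH)
  qed
qed

section \<open>Assembling the factorization\<close>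

theorem theorem2p2:
  fixes \<alpha> :: "nat list"
  assumes "\<alpha> \<noteq> []" and "hd \<alpha> > 0" and "last \<alpha> > 0"
  shows "\<exists>w z :: nat. mmp \<alpha> = [:0, 1:] ^ w * [:-1, 1:] ^ z * mmp [sum_list \<alpha>]"
proof -
  define r where "r = sum_list \<alpha>"
  define p where "p = mmp [r]"
  have r: "r > 0" using assms by (cases \<alpha>) (auto simp: r_def)
  \<comment> \<open>Since \<open>[r]\<close> is reachable, every polynomial annihilating the larger
    matrix annihilates that of \<open>[r]\<close>.\<close>
  have "Dset [r] \<subseteq> Dset \<alpha>"
    using singleton_reachable[OF canon_in_Dset, of \<alpha>] r by (intro Dset_mono) (simp add: r_def)
  then have "annihilates (mmp \<alpha>) (A_mat [r])"
    using mmp_properties(2)[of \<alpha>] by (auto simp: annihilates_A_mat)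
  then have "p dvd mmp \<alpha>" using mmp_properties(3) by (simp add: p_def)
  then obtain q where q: "mmp \<alpha> = p * q" by (elim dvdE)
  have p_short: "act p u b = 0" if "b \<in> Dset \<alpha>" "length b \<le> 2" for u b
  proof -
    have "b \<in> Dset [r]"
      using that r Dset_sum_list[of b \<alpha>] Dset_canon[of b \<alpha>]
      by (intro short_in_Dset_singleton) (auto simp: r_def)
    then show ?thesis
      using mmp_properties(2)[of "[r]"] by (simp add: annihilates_A_mat p_def)
  qed
  \<comment> \<open>Each end entry is at most \<open>r\<close>, so their sum is below
    \<open>?Z\<close>; lengths are at most \<open>max 3 ?W\<close>, hence at most
    \<open>?W + 3\<close>.\<close>
  let ?Z = "2 * r + 1" and ?W = "length (canon \<alpha>)"
  have three: "act ([:-1, 1:] ^ ?Z * p) u b = 0" if "b \<in> Dset \<alpha>" "length b \<le> 3" for u b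
    using that
  proof (rule annihilate_length_three)
    assume "length b = 3"
    then have "b \<noteq> []" by auto
    then have "hd b \<in> set b" "last b \<in> set b" by simp_all
    then have "hd b \<le> r" "last b \<le> r"
      using member_le_sum_list[of _ b] Dset_sum_list[OF that(1)] by (simp_all add: r_def)
    then show "hd b + last b < ?Z" by simp
  qed (use p_short in auto)
  \<comment> \<open>The trailing factor 1 gives the shape of \<open>dvd_linear_power_mult\<close>
    for both linear factors, so what finally remains divides 1.\<close>
  have comm: "X * (Y * p) = p * (X * (Y * 1))" for X Y by (simp add: mult_ac)
  have "act ([:0, 1:] ^ ?W * ([:-1, 1:] ^ ?Z * p)) u b = 0" if "b \<in> Dset \<alpha>" for u b
    using that Dset_length[OF that] three by (intro annihilate_long) auto
  then have "mmp \<alpha> dvd [:0, 1:] ^ ?W * ([:-1, 1:] ^ ?Z * p)"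
    by (intro mmp_properties(3)) (simp only: annihilates_A_mat, blast)
  then have "p * q dvd p * ([:0, 1:] ^ ?W * ([:-1, 1:] ^ ?Z * 1))"
    unfolding q comm .
  moreover have p: "lead_coeff p = 1" using mmp_properties(1) by (simp add: p_def)
  ultimately have "q dvd [:0, 1:] ^ ?W * ([:-1, 1:] ^ ?Z * 1)"
    by (metis dvd_mult_cancel_left leading_coeff_0_iff zero_neq_one)
  from dvd_linear_power_mult[OF this] obtain w s
    where w: "q = [:0, 1:] ^ w * s" "s dvd [:-1, 1:] ^ ?Z * 1" by blast
  from dvd_linear_power_mult[OF w(2)] obtain z s'
    where z: "s = [:-1, 1:] ^ z * s'" "s' dvd 1" by blast
  \<comment> \<open>The remaining unit is a constant; comparing leading coefficients of monic
    polynomials makes it 1.\<close>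
  obtain c where c: "s' = [:c:]" using z(2) by (auto simp: is_unit_poly_iff)
  have "lead_coeff (mmp \<alpha>) = c"
    using p by (simp add: q w z c lead_coeff_mult lead_coeff_power)
  then have "c = 1" using mmp_properties(1) by simp
  then have "mmp \<alpha> = [:0, 1:] ^ w * [:-1, 1:] ^ z * p"
    by (simp add: q w z c one_pCons[symmetric] mult_ac)
  then show ?thesis unfolding p_def r_def by blast
qed

end
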